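(* Suppose $P\in \hat{D}_1^{sym}\hat{\otimes}_K \tilde{K}$ satisfies condition $A_k(0)$, and $\mathbf{ord}(P)=p$. Then exactly one of the following conditions holds: 1. $Sdeg_A(P)=0$. 2. $Sdeg_A(P)>0$, and $P$ has the restriction top line. 3. $Sdeg_A(P)>0$, and $P$ has the asymptotic top line. In particular, the asymptotic top line is uniquely defined if it exists.
   Context: $K$ is a field of characteristic zero, $k>1$ an integer, $\xi$ a primitive $k$-th root of unity, $\tilde K=K[\xi]$. The ring $\hat D_1^{sym}\hat\otimes_K\tilde K$ consists of all formal sums $P=\sum_{s\ge 0}a_s(x)\partial^s$, $a_s\in\tilde K[[x]]$, with $\mathbf{ord}(P):=\sup_s\{s-\upsilon(a_s)\}<\infty$ ($\upsilon$ the $x$-adic valuation), with multiplication determined by $\partial a=a\partial+a'$. Writing $a_s=\sum_i\alpha_{s,i}x^i$, the homogeneous component of order $m$ is $P_m:=\sum_{s-i=m}\alpha_{s,i}x^i\partial^s$, and $\sigma(P):=P_{\mathbf{ord}(P)}$ is the highest symbol. Write $\exp(c\,x*\partial):=\sum_{s\ge0}\frac{c^s}{s!}x^s\partial^s$ and $\delta:=\exp((-1)x*\partial)$; $\int:=\sum_{s\ge1}\frac{(-1)^{s+1}}{s!}x^s\partial^{s-1}$; $D^r:=\partial^r$ for $r\ge0$ and $D^r:=\int^{-r}$ for $r<0$; $\Gamma_l:=(x\partial)^l$; $A_i=A_{k;i}:=\exp((\xi^i-1)x*\partial)$ for $0\le i<k$ (so $A_0=1$); $B_j:=\frac1{(j-1)!}x^{j-1}\delta\partial^{j-1}$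 for $j\ge1$. An HCP from $Hcpc(k)$ of order $r$ is an operator which can be written (G-form) as a finite sum $H=\bigl(\sum_{0\le i<k}\sum_{0\le l\le d_i}f_{l,i;r}\Gamma_lA_i+\sum_{0<j\le N}g_{j;r}B_j\bigr)D^r$, with $f_{l,i;r},g_{j;r}\in\tilde K$ and $g_{j;r}=0$ for $j\le -r$ if $r<0$; the coefficients are uniquely determined by $H$ ($H=0$ is allowed). $Sdeg_A(H)$ is the largest $l$ with some $f_{l,i;r}\neq0$ ($-\infty$ if all $f_{l,i;r}=0$); $Sdeg_B(H)$ is the largest $j$ with $g_{j;r}\ne0$ ($-\infty$ if none). $H$ is totally free of $B_j$ if $Sdeg_B(HD^n)=-\infty$ for all $n\in\mathbb Z$. Put $E(H):=\{(l,r): \exists i,\ f_{l,i;r}\ne0\}$. Condition $A_k(0)$ for $P$: (1) $P_t$ is an HCP from $Hcpc(k)$ for all $t$; (2) $P_t$ is totally free of $B_j$ for all $t$; (3) $Sdeg_A(P_{\mathbf{ord}(P)-i})<i$ for all $i>0$; (4) $\sigma(P)$ does not contain $A_{k;i}$ (i.e. in its G-form all coefficients at $\Gamma_lA_i$ with $i>0$ vanish) and $Sdeg_A(\sigma(P))=0$. For $P$ satisfying $A_k(0)$ put $Sdeg_A(P):=\sup_{i\in\mathbb Z}Sdeg_A(P_i)$ and $E(P):=\bigcup_rE(P_r)$. For real $\sigma\ge0$, $\rho>0$ put $v_{\sigma,\rho}(P):=\sup\{\sigma l+\rho j:(l,j)\in E(P)\}$. If some point of $E(P)$ attains this supremum (and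 it is finite), the line $\sigma X+\rho Y=v_{\sigma,\rho}(P)$ is called the $(\sigma,\rho)$-top line of $P$. Restriction top line: a $(\sigma,\rho)$-top line of $P$ which goes through $(0,p)\in E(P)$ and contains at least two points of $E(P)$. Asymptotic top line: if $P$ does not have the restriction top line but there is a top line $l_0:\sigma_0X+Y=p$ with $\sigma_0>0$ such that for every $\sigma>\sigma_0$ the line $\sigma X+Y=p$ is not the ($(\sigma,1)$-)top line of $P$, then $l_0$ is called the asymptotic top line. *)

theory Defs
  imports
    "HOL-Computational_Algebra.Polynomial"
    "HOL-Computational_Algebra.Formal_Power_Series"
    "HOL-Library.Extended_Real"
begin

text \<open>
  The coefficient field \<open>K~ = K[\<xi>]\<close> is a type \<open>'a\<close> of class \<open>field_char_0\<close>, the ground field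
  \<open>K\<close> is a subset of it.
\<close>

definition is_subfield :: "'a::field set \<Rightarrow> bool" where
  "is_subfield K \<longleftrightarrow> 0 \<in> K \<and> 1 \<in> K \<and>
     (\<forall>a\<in>K. \<forall>b\<in>K. a + b \<in> K \<and> a * b \<in> K) \<and> (\<forall>a\<in>K. - a \<in> K \<and> inverse a \<in> K)"

definition adjoin :: "'a::field set \<Rightarrow> 'a \<Rightarrow> 'a set" where
  "adjoin K \<xi> = {poly q \<xi> |q. \<forall>i. coeff q i \<in> K}"

definition primitive_root_of_unity :: "nat \<Rightarrow> 'a::field \<Rightarrow> bool" where
  "primitive_root_of_unity k \<xi> \<longleftrightarrow> \<xi> ^ k = 1 \<and> (\<forall>m. 0 < m \<and> m < k \<longrightarrow> \<xi> ^ m \<noteq> 1)"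


section \<open>Formal operators\<close>

text \<open>\<open>P :: 'a fop\<close> stands for the formal sum of the \<open>P s \<cdot> \<partial>\<^sup>s\<close> over all \<open>s\<close>.\<close>

type_synonym 'a fop = "nat \<Rightarrow> 'a fps"

text \<open>The index set omits the zero coefficients, whose valuation is infinite (whereas
  \<open>subdegree 0 = 0\<close>). In particular \<open>fop_ord 0 = -\<infinity>\<close>.\<close>

definition fop_ord :: "'a::zero fop \<Rightarrow> ereal" where
  "fop_ord P = (SUP s\<in>{s. P s \<noteq> 0}. ereal (real s - real (subdegree (P s))))"

definition Dsym :: "'a::zero fop set" where
  "Dsym = {P. fop_ord P < \<infinity>}"

text \<open>
  Iterating \<open>\<partial>a = a\<partial> + a'\<close> gives the Leibniz rule: \<open>(a\<partial>\<^sup>s)(b\<partial>\<^sup>t)\<close> is the sum over \<open>j \<le> s\<close> of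
  \<open>(s choose j) a b\<^sup>(\<^sup>j\<^sup>) \<partial>\<^bsup>s+t-j\<^esup>\<close>. Below, \<open>t = n + j - s\<close>, and \<open>\<alpha> x\<^sup>i\<close> runs through the nonzero
  terms of \<open>a\<close>. For \<open>P \<in> Dsym\<close> the index set is finite, because \<open>s - i\<close> is bounded above
  and \<open>i \<le> m\<close>.
\<close>

definition fop_mult :: "'a::field_char_0 fop \<Rightarrow> 'a fop \<Rightarrow> 'a fop"  (infixl "\<odot>" 70) where
  "P \<odot> Q = (\<lambda>n. Abs_fps (\<lambda>m.
     \<Sum>(s, i, j) \<in> {(s, i, j). fps_nth (P s) i \<noteq> 0 \<and> i \<le> m \<and> j \<le> s \<and> s \<le> n + j}.
       of_nat (s choose j) * fps_nth (P s) i *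
       fps_nth ((fps_deriv ^^ j) (Q (n + j - s))) (m - i)))"

definition fop_scale :: "'a::field_char_0 \<Rightarrow> 'a fop \<Rightarrow> 'a fop"  (infixr "\<cdot>\<^sub>s" 75) where
  "c \<cdot>\<^sub>s P = (\<lambda>s. fps_const c * P s)"

definition fop_mon :: "nat \<Rightarrow> nat \<Rightarrow> 'a::field_char_0 fop" where  \<comment> \<open>\<open>x\<^sup>i \<partial>\<^sup>s\<close>\<close>
  "fop_mon i s = (\<lambda>t. if t = s then fps_X ^ i else 0)"

fun fop_power :: "'a::field_char_0 fop \<Rightarrow> nat \<Rightarrow> 'a fop" where
  "fop_power P 0 = fop_mon 0 0"
| "fop_power P (Suc n) = fop_power P n \<odot> P"

definition hcomp :: "'a::field_char_0 fop \<Rightarrow> int \<Rightarrow> 'a fop" where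
  "hcomp P m = (\<lambda>s. Abs_fps (\<lambda>i. if int s - int i = m then fps_nth (P s) i else 0))"


section \<open>Homogeneous canonical polynomials\<close>

definition fop_exp :: "'a::field_char_0 \<Rightarrow> 'a fop" where
  "fop_exp c = (\<lambda>s. fps_const (c ^ s / fact s) * fps_X ^ s)"

definition fop_delta :: "'a::field_char_0 fop" where
  "fop_delta = fop_exp (- 1)"

definition fop_int :: "'a::field_char_0 fop" where
  "fop_int = (\<lambda>t. fps_const ((- 1) ^ (Suc t + 1) / fact (Suc t)) * fps_X ^ Suc t)"
    \<comment> \<open>shifted index \<open>t = s - 1\<close>\<close>

definition fop_D :: "int \<Rightarrow> 'a::field_char_0 fop" where
  "fop_D r = (if r \<ge> 0 then fop_mon 0 (nat r) else fop_power fop_int (nat (- r)))"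

definition fop_Gamma :: "nat \<Rightarrow> 'a::field_char_0 fop" where
  "fop_Gamma l = fop_power (fop_mon 1 1) l"

definition fop_A :: "'a::field_char_0 \<Rightarrow> nat \<Rightarrow> 'a fop" where
  "fop_A \<xi> i = fop_exp (\<xi> ^ i - 1)"

definition fop_B :: "nat \<Rightarrow> 'a::field_char_0 fop" where  \<comment> \<open>meant for \<open>j \<ge> 1\<close>\<close>
  "fop_B j = (1 / fact (j - 1)) \<cdot>\<^sub>s (fop_mon (j - 1) 0 \<odot> fop_delta \<odot> fop_mon 0 (j - 1))"

text \<open>\<open>f l i\<close> and \<open>g j\<close> are the coefficients at \<open>\<Gamma>\<^sub>l A\<^sub>i D\<^sup>r\<close> and \<open>B\<^sub>j D\<^sup>r\<close>. They are required to
  vanish outside the ranges of summation, so that,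
  for a primitive \<open>k\<close>-th root of unity \<open>\<xi>\<close>, the pair \<open>(f, g)\<close> is determined by \<open>H\<close> and \<open>r\<close>.\<close>

definition gform ::
    "nat \<Rightarrow> 'a::field_char_0 \<Rightarrow> int \<Rightarrow> (nat \<Rightarrow> nat \<Rightarrow> 'a) \<Rightarrow> (nat \<Rightarrow> 'a) \<Rightarrow> 'a fop \<Rightarrow> bool" where
  "gform k \<xi> r f g H \<longleftrightarrow> (\<exists>d :: nat \<Rightarrow> nat. \<exists>N.
     (\<forall>l i. f l i \<noteq> 0 \<longrightarrow> i < k \<and> l \<le> d i) \<and>
     (\<forall>j. g j \<noteq> 0 \<longrightarrow> 0 < j \<and> j \<le> N) \<and>
     (r < 0 \<longrightarrow> (\<forall>j. int j \<le> - r \<longrightarrow> g j = 0)) \<and>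
     H = (\<lambda>s. (\<Sum>i<k. \<Sum>l\<le>d i. (f l i \<cdot>\<^sub>s (fop_Gamma l \<odot> fop_A \<xi> i)) s)
              + (\<Sum>j=1..N. (g j \<cdot>\<^sub>s fop_B j) s)) \<odot> fop_D r)"

definition is_HCP :: "nat \<Rightarrow> 'a::field_char_0 \<Rightarrow> int \<Rightarrow> 'a fop \<Rightarrow> bool" where
  "is_HCP k \<xi> r H \<longleftrightarrow> (\<exists>f g. gform k \<xi> r f g H)"

definition gcoeffs ::
    "nat \<Rightarrow> 'a::field_char_0 \<Rightarrow> int \<Rightarrow> 'a fop \<Rightarrow> (nat \<Rightarrow> nat \<Rightarrow> 'a) \<times> (nat \<Rightarrow> 'a)" where
  "gcoeffs k \<xi> r H = (THE fg. gform k \<xi> r (fst fg) (snd fg) H)"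

definition coeffA :: "nat \<Rightarrow> 'a::field_char_0 \<Rightarrow> int \<Rightarrow> 'a fop \<Rightarrow> nat \<Rightarrow> nat \<Rightarrow> 'a" where
  "coeffA k \<xi> r H = fst (gcoeffs k \<xi> r H)"

definition coeffB :: "nat \<Rightarrow> 'a::field_char_0 \<Rightarrow> int \<Rightarrow> 'a fop \<Rightarrow> nat \<Rightarrow> 'a" where
  "coeffB k \<xi> r H = snd (gcoeffs k \<xi> r H)"

text \<open>Suprema of finite sets of naturals, i.e. maxima, with value \<open>-\<infinity>\<close> on the empty set. The
  order \<open>r\<close> is an argument since \<open>H = 0\<close> is an HCP of every order.\<close>

definition SdegA :: "nat \<Rightarrow> 'a::field_char_0 \<Rightarrow> int \<Rightarrow> 'a fop \<Rightarrow> ereal" where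
  "SdegA k \<xi> r H = (SUP l\<in>{l. \<exists>i. coeffA k \<xi> r H l i \<noteq> 0}. ereal (real l))"

definition SdegB :: "nat \<Rightarrow> 'a::field_char_0 \<Rightarrow> int \<Rightarrow> 'a fop \<Rightarrow> ereal" where
  "SdegB k \<xi> r H = (SUP j\<in>{j. coeffB k \<xi> r H j \<noteq> 0}. ereal (real j))"

definition totally_free_of_B :: "nat \<Rightarrow> 'a::field_char_0 \<Rightarrow> int \<Rightarrow> 'a fop \<Rightarrow> bool" where
  "totally_free_of_B k \<xi> r H \<longleftrightarrow> (\<forall>n::int. SdegB k \<xi> (r + n) (H \<odot> fop_D n) = - \<infinity>)"

definition E_HCP :: "nat \<Rightarrow> 'a::field_char_0 \<Rightarrow> int \<Rightarrow> 'a fop \<Rightarrow> (nat \<times> int) set" where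
  "E_HCP k \<xi> r H = {(l, r) |l. \<exists>i. coeffA k \<xi> r H l i \<noteq> 0}"


section \<open>Condition \<open>A\<^sub>k(0)\<close> and top lines\<close>

text \<open>The order is an integer here: it is not \<open>\<infinity>\<close> by membership in \<open>Dsym\<close>, and the last
  condition excludes \<open>P = 0\<close>.\<close>

definition cond_A0 :: "nat \<Rightarrow> 'a::field_char_0 \<Rightarrow> 'a fop \<Rightarrow> bool" where
  "cond_A0 k \<xi> P \<longleftrightarrow> (\<exists>p::int. fop_ord P = ereal (of_int p) \<and>
     (\<forall>t. is_HCP k \<xi> t (hcomp P t)) \<and>
     (\<forall>t. totally_free_of_B k \<xi> t (hcomp P t)) \<and>
     (\<forall>i::int. i > 0 \<longrightarrow> SdegA k \<xi> (p - i) (hcomp P (p - i)) < ereal (of_int i)) \<and>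
     (\<forall>l i. i > 0 \<longrightarrow> coeffA k \<xi> p (hcomp P p) l i = 0) \<and>
     SdegA k \<xi> p (hcomp P p) = 0)"

definition SdegA_op :: "nat \<Rightarrow> 'a::field_char_0 \<Rightarrow> 'a fop \<Rightarrow> ereal" where
  "SdegA_op k \<xi> P = (SUP i::int. SdegA k \<xi> i (hcomp P i))"

definition E_op :: "nat \<Rightarrow> 'a::field_char_0 \<Rightarrow> 'a fop \<Rightarrow> (nat \<times> int) set" where
  "E_op k \<xi> P = (\<Union>r. E_HCP k \<xi> r (hcomp P r))"

definition v_op :: "nat \<Rightarrow> 'a::field_char_0 \<Rightarrow> real \<Rightarrow> real \<Rightarrow> 'a fop \<Rightarrow> ereal" where
  "v_op k \<xi> \<sigma> \<rho> P = (SUP (l, j)\<in>E_op k \<xi> P. ereal (\<sigma> * real l + \<rho> * real_of_int j))"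

definition plane_line :: "real \<Rightarrow> real \<Rightarrow> real \<Rightarrow> (real \<times> real) set" where
  "plane_line \<sigma> \<rho> c = {(X, Y). \<sigma> * X + \<rho> * Y = c}"

text \<open>The existence of a point of \<open>E(P)\<close> attaining the supremum entails that it is finite.\<close>

definition is_top_line ::
    "nat \<Rightarrow> 'a::field_char_0 \<Rightarrow> 'a fop \<Rightarrow> real \<Rightarrow> real \<Rightarrow> (real \<times> real) set \<Rightarrow> bool" where
  "is_top_line k \<xi> P \<sigma> \<rho> L \<longleftrightarrow> \<sigma> \<ge> 0 \<and> \<rho> > 0 \<and>
     (\<exists>(l, j)\<in>E_op k \<xi> P. ereal (\<sigma> * real l + \<rho> * real_of_int j) = v_op k \<xi> \<sigma> \<rho> P) \<and>
     L = plane_line \<sigma> \<rho> (real_of_ereal (v_op k \<xi> \<sigma> \<rho> P))"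

definition E_on_line :: "nat \<Rightarrow> 'a::field_char_0 \<Rightarrow> 'a fop \<Rightarrow> (real \<times> real) set \<Rightarrow> (nat \<times> int) set" where
  "E_on_line k \<xi> P L = {(l, j) \<in> E_op k \<xi> P. (real l, real_of_int j) \<in> L}"

text \<open>In the following two definitions \<open>p\<close> is the order of \<open>P\<close>.\<close>

definition is_restriction_top_line ::
    "nat \<Rightarrow> 'a::field_char_0 \<Rightarrow> 'a fop \<Rightarrow> int \<Rightarrow> (real \<times> real) set \<Rightarrow> bool" where
  "is_restriction_top_line k \<xi> P p L \<longleftrightarrow>
     (\<exists>\<sigma> \<rho>. is_top_line k \<xi> P \<sigma> \<rho> L) \<and> (0, p) \<in> E_on_line k \<xi> P L \<and>
     (\<exists>a\<in>E_on_line k \<xi> P L. \<exists>b\<in>E_on_line k \<xi> P L. a \<noteq> b)"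

definition is_asymptotic_top_line ::
    "nat \<Rightarrow> 'a::field_char_0 \<Rightarrow> 'a fop \<Rightarrow> int \<Rightarrow> (real \<times> real) set \<Rightarrow> bool" where
  "is_asymptotic_top_line k \<xi> P p L \<longleftrightarrow>
     \<not> (\<exists>L'. is_restriction_top_line k \<xi> P p L') \<and>
     (\<exists>\<sigma>\<^sub>0>0. L = plane_line \<sigma>\<^sub>0 1 (of_int p) \<and> is_top_line k \<xi> P \<sigma>\<^sub>0 1 L \<and>
        (\<forall>\<sigma>>\<sigma>\<^sub>0. \<not> is_top_line k \<xi> P \<sigma> 1 (plane_line \<sigma> 1 (of_int p))))"

end

theory Submission
  imports Defs
begin

text \<open>
  Under the condition \<open>A\<^sub>k(0)\<close> the set \<open>E(P)\<close> consists of the vertex \<open>(0, p)\<close> and of points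
  \<open>(l, j)\<close> with \<open>l < p - j\<close> (\<open>cond_A0_E_op\<close>). A line \<open>\<sigma> X + Y = p\<close> with \<open>\<sigma> \<ge> 0\<close> goes
  through the vertex, so it is a top line if and only if no point of \<open>E(P)\<close> lies above it, which
  means that \<open>\<sigma> \<le> (p - j) / l\<close> for all \<open>(l, j) \<in> E(P)\<close> with \<open>l > 0\<close>
  (\<open>is_top_line_iff_le_slopes\<close>). If there is no such point then \<open>Sdeg\<^sub>A(P) = 0\<close>, and every
  \<open>\<sigma> \<ge> 0\<close> gives a top line, which leaves no asymptotic one. Otherwise \<open>Sdeg\<^sub>A(P) > 0\<close>, the numbers
  \<open>(p - j) / l\<close> are all greater than 1, and the steepest top line through the vertex is the one
  with \<open>\<sigma>\<close> equal to their infimum. This line is the only candidate for the asymptotic top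
  line, and it is the asymptotic top line exactly when there is no restriction top line
  (\<open>asymptotic_top_line_iff_slopes\<close>). Hence the three alternatives exclude each other and
  exhaust all cases.

  The bulk of the work is to show that \<open>E(P)\<close> has no points of order \<open>j > p\<close>. The homogeneous
  components of these orders vanish, so what is needed is that the G-form of the zero operator is
  trivial. In fact the G-form of any operator is unique (\<open>gform_unique\<close>). To see this, let
  operators act on the powers of \<open>x\<close>. A homogeneous operator of order \<open>m\<close> maps \<open>x\<^sup>n\<close> to a
  multiple of \<open>x\<^bsup>n-m\<^esup>\<close>, the product of operators corresponds to the composition of maps, and
  the building blocks of a G-form act in a very simple way: \<open>\<Gamma>\<^sub>l A\<^sub>i\<close> multiplies \<open>x\<^sup>n\<close> by
  \<open>n\<^sup>l \<xi>\<^bsup>in\<^esup>\<close>, the operator \<open>B\<^sub>j\<close> is the projection onto \<open>x\<^bsup>j-1\<^esup>\<close>, and \<open>D\<^sup>r\<close> multiplies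
  by a nonzero factor. For large \<open>n\<close> the \<open>B\<^sub>j\<close> are invisible, so the coefficients \<open>f\<close> are
  determined by the linear independence of the functions \<open>n\<^sup>l \<xi>\<^bsup>in\<^esup>\<close>, for which
  finitely many \<open>n\<close> may be discarded (\<open>exponential_polynomial_eq_0\<close>). The remaining
  \<open>n\<close> then determine the \<open>g\<^sub>j\<close>.
\<close>

section \<open>Exponential polynomials\<close>

lemma sum_powers_root_of_unity:
  fixes \<zeta> :: "'a::field"
  assumes "\<zeta> ^ k = 1" "\<zeta> \<noteq> 1"
  shows "(\<Sum>b<k. \<zeta> ^ b) = 0"
  using assms geometric_sum[of \<zeta> k] by simp

text \<open>On each residue class modulo \<open>k\<close> the powers of \<open>\<xi>\<close> are constant, so the expression agrees
  there with a single polynomial, which has infinitely many zeros. The discrete Fourier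
  transform over the residue classes recovers the individual \<open>F j\<close>.\<close>

lemma exponential_polynomial_eq_0:
  fixes \<xi> :: "'a::field_char_0" and F :: "nat \<Rightarrow> 'a poly"
  assumes k: "k > 0" and prim: "primitive_root_of_unity k \<xi>"
    and vanish: "\<And>n. n \<ge> M \<Longrightarrow> (\<Sum>i<k. \<xi> ^ (i * n) * poly (F i) (of_nat n)) = 0"
    and j: "j < k"
  shows "F j = 0"
proof -
  have \<xi>k: "\<xi> ^ k = 1" and \<xi>m: "\<And>m. 0 < m \<Longrightarrow> m < k \<Longrightarrow> \<xi> ^ m \<noteq> 1"
    using prim by (auto simp: primitive_root_of_unity_def)
  \<comment> \<open>the polynomial that gives the values on the residue class of \<open>b\<close>\<close>
  define G where "G b = (\<Sum>i<k. smult (\<xi> ^ (i * b)) (F i))" for b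
  have G0: "G b = 0" for b
  proof (rule ccontr)
    assume "G b \<noteq> 0"
    then have fin: "finite {x. poly (G b) x = 0}" by (rule poly_roots_finite)
    have root: "poly (G b) (of_nat (k * q + b)) = 0" if "q \<ge> M" for q
    proof -
      have "k * q + b \<ge> M" using that k
        by (metis le_trans mult.commute mult_le_mono2 mult_1_right Suc_leI One_nat_def trans_le_add1)
      from vanish[OF this] show ?thesis
        by (simp add: G_def poly_sum distrib_left power_add power_mult \<xi>k mult.left_commute[of _ k])
    qed
    have "inj (\<lambda>q. of_nat (k * q + b) :: 'a)"
      using k by (intro injI) (simp only: of_nat_eq_iff, simp)
    then have "infinite ((\<lambda>q. of_nat (k * q + b) :: 'a) ` {M..})"
      by (meson finite_imageD infinite_Ici inj_on_subset subset_UNIV)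
    moreover have "(\<lambda>q. of_nat (k * q + b) :: 'a) ` {M..} \<subseteq> {x. poly (G b) x = 0}"
      using root by auto
    ultimately show False using fin finite_subset by blast
  qed
  \<comment> \<open>\<open>\<xi> ^ (k - j)\<close> serves as the inverse of \<open>\<xi> ^ j\<close>\<close>
  have orth: "(\<Sum>b<k. \<xi> ^ ((k - j) * b) * \<xi> ^ (i * b)) = (if i = j then of_nat k else 0)"
    if "i < k" for i
  proof -
    define e where "e = k - j + i"
    have "(\<Sum>b<k. \<xi> ^ ((k - j) * b) * \<xi> ^ (i * b)) = (\<Sum>b<k. (\<xi> ^ e) ^ b)"
      by (simp add: e_def power_mult[symmetric] power_add[symmetric] distrib_right)
    also have "\<dots> = (if i = j then of_nat k else 0)"
    proof (cases "i = j")
      case True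
      then have "e = k" using j by (simp add: e_def)
      then show ?thesis using True \<xi>k by simp
    next
      case False
      have "\<xi> ^ e \<noteq> 1"
      proof (cases "i < j")
        case True
        then show ?thesis using j \<xi>m[of e] by (simp add: e_def)
      next
        case ge: False
        have "e = k + (i - j)" using ge j by (simp add: e_def)
        then have "\<xi> ^ e = \<xi> ^ (i - j)" by (simp add: power_add \<xi>k)
        then show ?thesis using \<xi>m[of "i - j"] ge False that by simp
      qed
      moreover have "(\<xi> ^ e) ^ k = 1"
        by (metis \<xi>k power_mult mult.commute power_one)
      ultimately show ?thesis using False sum_powers_root_of_unity by simp
    qed
    finally show ?thesis .
  qed
  have "0 = (\<Sum>b<k. smult (\<xi> ^ ((k - j) * b)) (G b))" by (simp add: G0)
  also have "\<dots> = (\<Sum>b<k. \<Sum>i<k. smult (\<xi> ^ ((k - j) * b) * \<xi> ^ (i * b)) (F i))"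
    by (intro sum.cong[OF refl] poly_eqI)
      (simp add: G_def coeff_sum sum_distrib_left mult.assoc)
  also have "\<dots> = (\<Sum>i<k. \<Sum>b<k. smult (\<xi> ^ ((k - j) * b) * \<xi> ^ (i * b)) (F i))"
    by (rule sum.swap)
  also have "\<dots> = (\<Sum>i<k. smult (\<Sum>b<k. \<xi> ^ ((k - j) * b) * \<xi> ^ (i * b)) (F i))"
    by (simp add: smult_sum)
  also have "\<dots> = (\<Sum>i<k. if i = j then smult (of_nat k) (F j) else 0)"
    by (intro sum.cong) (auto simp: orth)
  also have "\<dots> = smult (of_nat k) (F j)" using j by simp
  finally show ?thesis using k by simp
qed

section \<open>The action of homogeneous operators on powers of \<open>x\<close>\<close>

definition homogeneous :: "int \<Rightarrow> 'a::zero fop \<Rightarrow> bool" where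
  "homogeneous m P \<longleftrightarrow> (\<forall>s i. fps_nth (P s) i \<noteq> 0 \<longrightarrow> int s - int i = m)"

text \<open>A homogeneous operator \<open>P\<close> of order \<open>m\<close> satisfies \<open>P x\<^sup>n = eig m P n \<cdot> x\<^bsup>n-m\<^esup>\<close>, because
  \<open>\<partial>\<^sup>s x\<^sup>n = s! (n choose s) x\<^bsup>n-s\<^esup>\<close> and the coefficient of \<open>P\<close> at \<open>\<partial>\<^sup>s\<close> is a multiple of
  \<open>x\<^bsup>s-m\<^esup>\<close>. For \<open>s < m\<close> this coefficient vanishes, so that the truncation by \<open>nat\<close> is
  harmless. Products \<open>s! (n choose s)\<close> denote the falling factorials throughout: unlike
  \<open>n! / (n - s)!\<close>, they are correct (namely 0) for \<open>s > n\<close>.\<close>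

definition eig :: "int \<Rightarrow> 'a::field_char_0 fop \<Rightarrow> nat \<Rightarrow> 'a" where
  "eig m P n = (\<Sum>s\<le>n. of_nat (fact s * (n choose s)) * fps_nth (P s) (nat (int s - m)))"

lemma funpow_fps_deriv_nth:
  "fps_nth ((fps_deriv ^^ j) a) n
     = of_nat (fact j * ((n + j) choose j)) * fps_nth (a :: 'a::field_char_0 fps) (n + j)"
proof (induction j arbitrary: n)
  case (Suc j)
  have "fps_nth ((fps_deriv ^^ Suc j) a) n
     = of_nat (Suc n * (fact j * ((Suc n + j) choose j))) * fps_nth a (Suc n + j)"
    by (simp only: funpow.simps o_apply fps_deriv_nth Suc.IH Suc_eq_plus1[symmetric] of_nat_mult mult.assoc)
  also have "Suc n * (fact j * ((Suc n + j) choose j)) = fact (Suc j) * ((n + Suc j) choose Suc j)"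
    using Suc_times_binomial_add[of j n]
    by (metis add.commute add_Suc add_Suc_right fact_Suc mult.assoc mult.commute of_nat_id)
  finally show ?case by simp
qed simp

text \<open>The Leibniz rule for \<open>\<partial>\<^sup>s (x\<^sup>u x\<^sup>w)\<close>, on the level of the coefficients.\<close>

lemma falling_factorial_Vandermonde:
  "fact s * ((u + w) choose s)
     = (\<Sum>j\<le>s. (s choose j) * (fact j * (u choose j)) * (fact (s - j) * (w choose (s - j))) :: nat)"
proof -
  have "fact s * ((u + w) choose s) = (\<Sum>j\<le>s. fact s * ((u choose j) * (w choose (s - j))))"
    by (simp add: vandermonde[symmetric] sum_distrib_left)
  also have "\<dots> = (\<Sum>j\<le>s. (s choose j) * (fact j * (u choose j)) * (fact (s - j) * (w choose (s - j))))"
  proof (rule sum.cong[OF refl])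
    fix j assume "j \<in> {..s}"
    then have "fact j * fact (s - j) * (s choose j) = (fact s :: nat)"
      using binomial_fact_lemma[of j s] by simp
    then show "fact s * ((u choose j) * (w choose (s - j)))
        = (s choose j) * (fact j * (u choose j)) * (fact (s - j) * (w choose (s - j)))"
      by (metis (no_types, lifting) mult.assoc mult.commute mult.left_commute)
  qed
  finally show ?thesis .
qed

text \<open>The law \<open>\<partial>\<^bsup>v+i\<^esup> x\<^sup>n = \<partial>\<^sup>i \<partial>\<^sup>v x\<^sup>n\<close>, on the level of the coefficients.\<close>

lemma falling_factorial_add:
  "fact (v + i) * (n choose (v + i)) = fact v * (n choose v) * (fact i * ((n - v) choose i) :: nat)"
proof (cases "v + i \<le> n")
  case True
  have "(n choose (v + i)) * ((v + i) choose v) = (n choose v) * ((n - v) choose i)"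
    using choose_mult[of v "v + i" n] True by simp
  moreover have "fact v * fact i * ((v + i) choose v) = (fact (v + i) :: nat)"
    using binomial_fact_lemma[of v "v + i"] by simp
  ultimately show ?thesis
    by (metis (no_types, lifting) mult.assoc mult.commute mult.left_commute)
next
  case False
  then have "n choose (v + i) = 0" "n choose v = 0 \<or> (n - v) choose i = 0"
    by auto
  then show ?thesis by (auto simp: binomial_eq_0)
qed

lemma sum_triangle_swap:
  "(\<Sum>t\<le>n. \<Sum>v\<le>t. F t v) = (\<Sum>v\<le>n. \<Sum>t=v..n. F t v)" for n :: nat and F :: "nat \<Rightarrow> nat \<Rightarrow> 'a::comm_monoid_add"
  by (simp add: sum.Sigma, rule sum.reindex_bij_witness[of _ "\<lambda>(v, t). (t, v)" "\<lambda>(t, v). (v, t)"]) auto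

lemma homogeneous_nth_eq_0: "homogeneous m P \<Longrightarrow> int s - int i \<noteq> m \<Longrightarrow> fps_nth (P s) i = 0"
  by (auto simp: homogeneous_def)

text \<open>For homogeneous factors the exponent \<open>i\<close> of \<open>x\<close> in the sum that defines the product is determined
  by \<open>s\<close>. Using the order \<open>v = t + j - s\<close> of the derivative in the second factor in place of
  \<open>j\<close> turns the index set into a rectangle. It may be taken as large as one likes, since the
  additional terms vanish; owing to this freedom in \<open>S\<close>, the same range of \<open>s\<close> serves for all
  \<open>t\<close> when the coefficients are summed over \<open>t\<close> in \<open>eig_fop_mult\<close>.\<close>

lemma fop_mult_homogeneous_nth:
  assumes P: "homogeneous m P" and Q: "homogeneous m' Q"
    and a: "int t - int a = m + m'" and S: "int t - m' \<le> int S"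
  shows "fps_nth ((P \<odot> Q) t) a =
    (\<Sum>v\<le>t. \<Sum>s\<le>S. of_nat ((s choose (t - v)) * (fact (s - (t - v)) * (nat (int v - m') choose (s - (t - v)))))
        * fps_nth (P s) (nat (int s - m)) * fps_nth (Q v) (nat (int v - m')))"
proof -
  define I where "I = {(s, i, j). fps_nth (P s) i \<noteq> 0 \<and> i \<le> a \<and> j \<le> s \<and> s \<le> t + j}"
  define T where "T = {..t} \<times> {..S}"
  define g where "g = (\<lambda>(s, i, j). of_nat (s choose j) * fps_nth (P s) i *
       fps_nth ((fps_deriv ^^ j) (Q (t + j - s))) (a - i))"
  define h where "h = (\<lambda>(v, s). of_nat ((s choose (t - v)) * (fact (s - (t - v)) * (nat (int v - m') choose (s - (t - v)))))
        * fps_nth (P s) (nat (int s - m)) * fps_nth (Q v) (nat (int v - m')))"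
  \<comment> \<open>\<open>\<phi>\<close> and \<open>\<psi>\<close> are the mutually inverse changes of variables between the nonzero terms\<close>
  define \<phi> :: "nat \<times> nat \<times> nat \<Rightarrow> nat \<times> nat" where "\<phi> = (\<lambda>(s, i, j). (t + j - s, s))"
  define \<psi> where "\<psi> = (\<lambda>(v, s). (s, nat (int s - m), s - (t - v)))"
  have "I \<subseteq> {..nat (int a + m)} \<times> {..a} \<times> {..nat (int a + m)}"
    using P by (force simp: I_def homogeneous_def)
  then have finI: "finite I" by (rule finite_subset) auto
  have finT: "finite T" by (simp add: T_def)
  have gh: "h (\<phi> x) = g x" "\<phi> x \<in> T"
    "\<psi> (\<phi> x) = x"
    if x: "x \<in> I" for x
  proof -
    obtain s i j where x_eq: "x = (s, i, j)" by (cases x) auto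
    have *: "fps_nth (P s) i \<noteq> 0" "i \<le> a" "j \<le> s" "s \<le> t + j" using x by (auto simp: I_def x_eq)
    then have i: "int s - int i = m" using P by (auto simp: homogeneous_def)
    have n: "nat (int s - m) = i" "nat (int (t + j - s) - m') = a - i + j" "t - (t + j - s) = s - j"
      "s - (s - j) = j"
      using * i a by auto
    show "h (\<phi> x) = g x"
      using * by (simp add: \<phi>_def h_def g_def x_eq n funpow_fps_deriv_nth binomial_symmetric[symmetric] mult_ac
          del: of_nat_diff)
    show "\<phi> x \<in> T"
      using * i a S by (auto simp: T_def x_eq \<phi>_def)
    show "\<psi> (\<phi> x) = x"
      using n by (simp add: x_eq \<phi>_def \<psi>_def)
  qed
  have inv: "\<psi> y \<in> I"
    "\<phi> (\<psi> y) = y"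
    if y: "y \<in> T" "h y \<noteq> 0" for y
  proof -
    obtain v s where y_eq: "y = (v, s)" by (cases y) auto
    have "s choose (t - v) \<noteq> 0" "nat (int v - m') choose (s - (t - v)) \<noteq> 0"
      and P0: "fps_nth (P s) (nat (int s - m)) \<noteq> 0" and Q0: "fps_nth (Q v) (nat (int v - m')) \<noteq> 0"
      using y(2) by (auto simp: h_def y_eq)
    then have le: "t - v \<le> s" "s - (t - v) \<le> nat (int v - m')"
      by (meson binomial_eq_0 not_le)+
    have "int s - int (nat (int s - m)) = m" "int v - int (nat (int v - m')) = m'"
      using P0 P Q0 Q by (auto simp only: homogeneous_def)
    then have "int s \<ge> m" "int v \<ge> m'" by linarith+
    moreover have "v \<le> t" using y by (auto simp: T_def y_eq)
    ultimately show "\<psi> y \<in> I"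
      "\<phi> (\<psi> y) = y"
      using le a P0 by (auto simp: I_def y_eq \<phi>_def \<psi>_def)
  qed
  have inv': "g (\<psi> y) \<noteq> 0" if "y \<in> T" "h y \<noteq> 0" for y
    using gh(1)[OF inv(1)[OF that]] inv(2)[OF that] that by simp
  have "fps_nth ((P \<odot> Q) t) a = sum g I"
    by (simp add: fop_mult_def g_def I_def)
  also have "\<dots> = sum h T"
    by (rule sum.reindex_bij_witness_not_neutral[where S' = "{x \<in> I. g x = 0}" and T' = "{y \<in> T. h y = 0}"
          and i = \<psi> and j = \<phi>])
      (use gh inv inv' finI finT in auto)
  finally show ?thesis by (simp only: h_def T_def sum.cartesian_product)
qed

lemma homogeneous_fop_mult:
  assumes P: "homogeneous m P" and Q: "homogeneous m' Q"
  shows "homogeneous (m + m') (P \<odot> Q)"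
  unfolding homogeneous_def
proof (intro allI impI)
  fix t a assume "fps_nth ((P \<odot> Q) t) a \<noteq> 0"
  then obtain s i j where "fps_nth (P s) i \<noteq> 0" "i \<le> a" "j \<le> s" "s \<le> t + j"
    "fps_nth ((fps_deriv ^^ j) (Q (t + j - s))) (a - i) \<noteq> 0"
    by (force simp: fop_mult_def elim!: sum.not_neutral_contains_not_neutral)
  then show "int t - int a = m + m'"
    using P Q by (force simp: homogeneous_def funpow_fps_deriv_nth)
qed

text \<open>The product of operators acts by composition: \<open>Q\<close> maps \<open>x\<^sup>n\<close> to a multiple of
  \<open>x\<^bsup>n-m'\<^esup>\<close>, on which \<open>P\<close> acts next. If \<open>n < m'\<close>, both sides vanish because
  \<open>eig m' Q n = 0\<close>. For \<open>P = \<partial>\<^sup>s\<close> and \<open>Q = x\<^sup>u \<partial>\<^sup>v\<close> the formula is the Leibniz rule for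
  \<open>\<partial>\<^sup>s (x\<^sup>u x\<^bsup>n-v\<^esup>)\<close>; the general case follows by summation over \<open>s\<close> and \<open>v\<close>.\<close>

lemma eig_fop_mult:
  assumes P: "homogeneous m P" and Q: "homogeneous m' Q"
  shows "eig (m + m') (P \<odot> Q) n = eig m P (nat (int n - m')) * eig m' Q n"
proof -
  define S where "S = nat (int n - m')"
  define cP where "cP s = fps_nth (P s) (nat (int s - m))" for s
  define cQ where "cQ v = fps_nth (Q v) (nat (int v - m'))" for v
  have cQ0: "cQ v = 0" if "int v < m'" for v
    using homogeneous_nth_eq_0[OF Q, of v "nat (int v - m')"] that by (auto simp: cQ_def)
  \<comment> \<open>the coefficient of the term of \<open>\<partial>\<^sup>s x\<^bsup>v-m'\<^esup>\<close> in which \<open>d\<close> of the \<open>s\<close> derivatives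
     pass the power of \<open>x\<close>\<close>
  define w where "w v s d = (s choose d) * (fact (s - d) * (nat (int v - m') choose (s - d)))" for v s d :: nat
  have coeff: "fps_nth ((P \<odot> Q) t) (nat (int t - (m + m')))
      = (\<Sum>v\<le>t. \<Sum>s\<le>S. of_nat (w v s (t - v)) * cP s * cQ v)" if "t \<le> n" for t
  proof (cases "int t < m + m'")
    case True
    have "w v s (t - v) = 0 \<or> cP s = 0 \<or> cQ v = 0" if "v \<le> t" for v s
    proof (rule ccontr)
      assume "\<not> ?thesis"
      then have "s - (t - v) \<le> nat (int v - m')" "t - v \<le> s" "int v \<ge> m'" "int s \<ge> m"
        using homogeneous_nth_eq_0[OF P, of s "nat (int s - m)"] cQ0[of v]
        by (auto simp: w_def cP_def not_less[symmetric] binomial_eq_0)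
      then show False using True that by linarith
    qed
    then have "(\<Sum>v\<le>t. \<Sum>s\<le>S. of_nat (w v s (t - v)) * cP s * cQ v) = 0"
      by (intro sum.neutral ballI) auto
    moreover have "fps_nth ((P \<odot> Q) t) (nat (int t - (m + m'))) = 0"
      using True by (intro homogeneous_nth_eq_0[OF homogeneous_fop_mult[OF P Q]]) auto
    ultimately show ?thesis by simp
  next
    case False
    then show ?thesis unfolding w_def cP_def cQ_def
      using that by (intro fop_mult_homogeneous_nth[OF P Q]) (auto simp: S_def)
  qed
  \<comment> \<open>the contribution of a fixed pair \<open>(s, v)\<close>, which is where the Leibniz rule enters\<close>
  have inner: "(\<Sum>t=v..n. of_nat (fact t * (n choose t)) * (of_nat (w v s (t - v)) * cP s * cQ v))
      = of_nat (fact v * (n choose v)) * cQ v * (of_nat (fact s * (S choose s)) * cP s)"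
    if v: "v \<le> n" for v s
  proof (cases "int v < m'")
    case False
    have "(\<Sum>t=v..n. fact t * (n choose t) * w v s (t - v))
        = (\<Sum>i\<le>n - v. fact (v + i) * (n choose (v + i)) * w v s i)"
      by (rule sum.reindex_bij_witness[of _ "\<lambda>i. v + i" "\<lambda>t. t - v"]) (use v in auto)
    also have "\<dots> = fact v * (n choose v) * (\<Sum>i\<le>n - v. fact i * ((n - v) choose i) * w v s i)"
      by (simp only: falling_factorial_add sum_distrib_left mult.assoc)
    also have "(\<Sum>i\<le>n - v. fact i * ((n - v) choose i) * w v s i)
        = (\<Sum>i\<le>s. fact i * ((n - v) choose i) * w v s i)"
      by (rule sum.mono_neutral_cong) (auto simp: w_def binomial_eq_0)
    also have "\<dots> = fact s * ((n - v + nat (int v - m')) choose s)"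
      unfolding falling_factorial_Vandermonde w_def by (intro sum.cong) (auto simp: mult_ac)
    also have "n - v + nat (int v - m') = S" using v False by (simp add: S_def)
    finally have *: "(\<Sum>t=v..n. fact t * (n choose t) * w v s (t - v)) = fact v * (n choose v) * (fact s * (S choose s))" .
    have "(\<Sum>t=v..n. of_nat (fact t * (n choose t)) * (of_nat (w v s (t - v)) * cP s * cQ v))
        = of_nat (\<Sum>t=v..n. fact t * (n choose t) * w v s (t - v)) * (cP s * cQ v)"
      by (simp add: sum_distrib_right mult.assoc)
    then show ?thesis unfolding * by (simp add: mult_ac)
  qed (simp add: cQ0)
  have "eig (m + m') (P \<odot> Q) n
      = (\<Sum>t\<le>n. \<Sum>v\<le>t. \<Sum>s\<le>S. of_nat (fact t * (n choose t)) * (of_nat (w v s (t - v)) * cP s * cQ v))"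
    unfolding eig_def by (intro sum.cong[OF refl]) (simp only: coeff atMost_iff sum_distrib_left)
  also have "\<dots> = (\<Sum>v\<le>n. \<Sum>t=v..n. \<Sum>s\<le>S. of_nat (fact t * (n choose t)) * (of_nat (w v s (t - v)) * cP s * cQ v))"
    by (rule sum_triangle_swap)
  also have "\<dots> = (\<Sum>v\<le>n. \<Sum>s\<le>S. of_nat (fact v * (n choose v)) * cQ v * (of_nat (fact s * (S choose s)) * cP s))"
    by (subst sum.swap, intro sum.cong[OF refl] inner) simp
  also have "\<dots> = (\<Sum>v\<le>n. of_nat (fact v * (n choose v)) * cQ v) * (\<Sum>s\<le>S. of_nat (fact s * (S choose s)) * cP s)"
    by (simp only: sum_product)
  finally show ?thesis by (simp add: eig_def S_def cP_def cQ_def mult.commute)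
qed

lemma homogeneous_eig_add:
  assumes "homogeneous m P" "homogeneous m Q"
  shows "homogeneous m (\<lambda>s. P s + Q s)" "eig m (\<lambda>s. P s + Q s) n = eig m P n + eig m Q n"
  using assms by (auto simp: homogeneous_def eig_def distrib_left sum.distrib) (metis add.right_neutral)

lemma homogeneous_eig_sum:
  assumes "finite I" "\<And>i. i \<in> I \<Longrightarrow> homogeneous m (P i)"
  shows "homogeneous m (\<lambda>s. \<Sum>i\<in>I. P i s)"
    and "eig m (\<lambda>s. \<Sum>i\<in>I. P i s) n = (\<Sum>i\<in>I. eig m (P i) n)"
  using assms
  by (induction I rule: finite_induct) (simp_all add: homogeneous_eig_add, simp_all add: homogeneous_def eig_def)

lemma homogeneous_eig_scale:
  assumes "homogeneous m P"
  shows "homogeneous m (c \<cdot>\<^sub>s P)" "eig m (c \<cdot>\<^sub>s P) n = c * eig m P n"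
  using assms by (auto simp: homogeneous_def eig_def fop_scale_def sum_distrib_left mult_ac)

section \<open>The action of the building blocks of a G-form\<close>

lemma homogeneous_eig_mon:
  shows "homogeneous (int s - int i) (fop_mon i s :: 'a::field_char_0 fop)"
    and "eig (int s - int i) (fop_mon i s) n = (of_nat (fact s * (n choose s)) :: 'a)"
proof -
  show "homogeneous (int s - int i) (fop_mon i s :: 'a fop)"
    by (auto simp: homogeneous_def fop_mon_def)
  have "eig (int s - int i) (fop_mon i s) n
      = (\<Sum>t\<le>n. if t = s then of_nat (fact s * (n choose s)) else (0::'a))"
    unfolding eig_def by (intro sum.cong) (auto simp: fop_mon_def)
  then show "eig (int s - int i) (fop_mon i s) n = (of_nat (fact s * (n choose s)) :: 'a)"
    by (simp add: binomial_eq_0)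
qed

text \<open>By the Taylor expansion \<open>exp(c x * \<partial>)\<close> is the substitution of \<open>(1 + c) x\<close> for \<open>x\<close>.\<close>

lemma homogeneous_eig_exp:
  shows "homogeneous 0 (fop_exp c)" "eig 0 (fop_exp c) n = (1 + c) ^ n"
proof -
  show "homogeneous 0 (fop_exp c)" by (auto simp: homogeneous_def fop_exp_def)
  have "eig 0 (fop_exp c) n = (\<Sum>s\<le>n. of_nat (n choose s) * c ^ s)"
    by (simp add: eig_def fop_exp_def)
  then show "eig 0 (fop_exp c) n = (1 + c) ^ n"
    by (simp add: binomial_ring[of c 1] add.commute[of 1])
qed

lemma homogeneous_eig_Gamma:
  shows "homogeneous 0 (fop_Gamma l :: 'a::field_char_0 fop)"
    and "eig 0 (fop_Gamma l) n = (of_nat n ^ l :: 'a)"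
proof -
  have "homogeneous 0 (fop_Gamma l :: 'a fop) \<and> (\<forall>n. eig 0 (fop_Gamma l) n = (of_nat n ^ l :: 'a))"
  proof (induction l)
    case 0
    show ?case using homogeneous_eig_mon[where 'a = 'a, of 0 0] by (simp add: fop_Gamma_def)
  next
    case (Suc l)
    then show ?case
      using homogeneous_fop_mult[of 0 "fop_Gamma l :: 'a fop" 0 "fop_mon 1 1"]
        eig_fop_mult[of 0 "fop_Gamma l :: 'a fop" 0 "fop_mon 1 1"]
        homogeneous_eig_mon[where 'a = 'a, of 1 1]
      by (simp add: fop_Gamma_def mult.commute)
  qed
  then show "homogeneous 0 (fop_Gamma l :: 'a fop)" "eig 0 (fop_Gamma l) n = (of_nat n ^ l :: 'a)"
    by auto
qed

lemma homogeneous_eig_Gamma_A: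
  shows "homogeneous 0 (fop_Gamma l \<odot> fop_A \<xi> i)"
    and "eig 0 (fop_Gamma l \<odot> fop_A \<xi> i) n = of_nat n ^ l * \<xi> ^ (i * n)"
  using homogeneous_fop_mult[OF homogeneous_eig_Gamma(1)[of l] homogeneous_eig_exp(1)[of "\<xi> ^ i - 1"]]
    eig_fop_mult[OF homogeneous_eig_Gamma(1)[of l] homogeneous_eig_exp(1)[of "\<xi> ^ i - 1"], of n]
  by (simp_all add: fop_A_def homogeneous_eig_Gamma homogeneous_eig_exp power_mult)

text \<open>As \<open>exp(c x * \<partial>)\<close> with \<open>c = - 1\<close>, the operator \<open>\<delta>\<close> is the evaluation at 0, so that \<open>B\<^sub>j\<close> picks the term
  of degree \<open>j - 1\<close> of the Taylor expansion.\<close>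

lemma homogeneous_eig_B:
  shows "homogeneous 0 (fop_B (Suc j) :: 'a::field_char_0 fop)"
    and "eig 0 (fop_B (Suc j)) n = (if n = j then 1 else 0 :: 'a)"
proof -
  have x: "homogeneous (- int j) (fop_mon j 0 :: 'a fop)" "eig (- int j) (fop_mon j 0) n = (1::'a)" for n
    using homogeneous_eig_mon[where 'a = 'a, of 0 j] by simp_all
  have d: "homogeneous (int j) (fop_mon 0 j :: 'a fop)" "eig (int j) (fop_mon 0 j) n = (of_nat (fact j * (n choose j)) :: 'a)"
    using homogeneous_eig_mon[where 'a = 'a, of j 0] by simp_all
  have \<delta>: "homogeneous 0 (fop_delta :: 'a fop)" "eig 0 fop_delta n = (0 :: 'a) ^ n" for n
    using homogeneous_eig_exp[of "- 1 :: 'a"] by (simp_all add: fop_delta_def)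
  have x\<delta>: "homogeneous (- int j) (fop_mon j 0 \<odot> fop_delta :: 'a fop)"
    "eig (- int j) (fop_mon j 0 \<odot> fop_delta) n = (0 :: 'a) ^ n" for n
    using homogeneous_fop_mult[OF x(1) \<delta>(1)] eig_fop_mult[OF x(1) \<delta>(1)] by (simp_all add: x \<delta>)
  have B: "homogeneous 0 (fop_mon j 0 \<odot> fop_delta \<odot> fop_mon 0 j :: 'a fop)"
    "eig 0 (fop_mon j 0 \<odot> fop_delta \<odot> fop_mon 0 j) n
       = (0 :: 'a) ^ nat (int n - int j) * of_nat (fact j * (n choose j))"
    using homogeneous_fop_mult[OF x\<delta>(1) d(1)] eig_fop_mult[OF x\<delta>(1) d(1)] by (simp_all add: x\<delta> d)
  show "homogeneous 0 (fop_B (Suc j) :: 'a fop)" "eig 0 (fop_B (Suc j)) n = (if n = j then 1 else 0 :: 'a)"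
    using B by (cases n j rule: linorder_cases; simp add: fop_B_def homogeneous_eig_scale binomial_eq_0)+
qed

text \<open>\<open>\<integral>\<close> is the integration from 0: it maps \<open>x\<^sup>n\<close> to \<open>x\<^bsup>n+1\<^esup> / (n + 1)\<close>. On the level of the
  coefficients this is the expansion of \<open>(1 - 1)\<^bsup>n+1\<^esup> = 0\<close>.\<close>

lemma homogeneous_eig_int:
  shows "homogeneous (- 1) (fop_int :: 'a::field_char_0 fop)"
    and "eig (- 1) fop_int n = (1 / of_nat (Suc n) :: 'a)"
proof -
  show "homogeneous (- 1) (fop_int :: 'a fop)" by (auto simp: homogeneous_def fop_int_def)
  have summand: "of_nat (fact s * (n choose s)) * fps_nth (fop_int s) (nat (int s - - 1))
      = - ((- 1) ^ Suc s * of_nat (Suc n choose Suc s)) / (of_nat (Suc n) :: 'a)" for s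
  proof -
    have "of_nat (Suc n) * of_nat (n choose s) = (of_nat (Suc s) * of_nat (Suc n choose Suc s) :: 'a)"
      by (metis Suc_times_binomial_eq mult.commute of_nat_mult)
    then show ?thesis
      by (simp add: fop_int_def nat_add_distrib field_simps del: of_nat_Suc binomial_Suc_Suc)
  qed
  have "0 = (- 1 + 1 :: 'a) ^ Suc n" by simp
  also have "\<dots> = (\<Sum>s\<le>Suc n. of_nat (Suc n choose s) * (- 1) ^ s)"
    by (subst binomial_ring) simp
  also have "\<dots> = 1 + (\<Sum>s\<le>n. (- 1) ^ Suc s * of_nat (Suc n choose Suc s))"
    by (subst sum.atMost_Suc_shift) (simp add: mult.commute del: binomial_Suc_Suc)
  finally have "(\<Sum>s\<le>n. (- 1) ^ Suc s * of_nat (Suc n choose Suc s)) = (- 1 :: 'a)"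
    by (simp add: add_eq_0_iff del: binomial_Suc_Suc)
  then show "eig (- 1) fop_int n = (1 / of_nat (Suc n) :: 'a)"
    unfolding eig_def summand
    by (simp only: sum_divide_distrib[symmetric] sum_negf) simp
qed

lemma homogeneous_eig_D:
  shows "homogeneous r (fop_D r :: 'a::field_char_0 fop)"
    and "r \<le> int n \<Longrightarrow> eig r (fop_D r) n \<noteq> (0 :: 'a)"
proof -
  have int_power: "homogeneous (- int q) (fop_power fop_int q :: 'a fop)
      \<and> (\<forall>n. eig (- int q) (fop_power fop_int q) n \<noteq> (0 :: 'a))" for q
  proof (induction q)
    case 0
    show ?case using homogeneous_eig_mon[where 'a = 'a, of 0 0] by simp
  next
    case (Suc q)
    have order: "- int (Suc q) = - int q + - 1" by simp
    from Suc show ?case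
      unfolding order
      using homogeneous_fop_mult[OF _ homogeneous_eig_int(1), of "- int q" "fop_power fop_int q :: 'a fop"]
        eig_fop_mult[OF _ homogeneous_eig_int(1), of "- int q" "fop_power fop_int q :: 'a fop"]
      by (simp add: homogeneous_eig_int del: of_nat_Suc)
  qed
  show "homogeneous r (fop_D r :: 'a fop)"
    using homogeneous_eig_mon(1)[where 'a = 'a, of "nat r" 0] int_power[of "nat (- r)"] by (auto simp: fop_D_def)
  show "eig r (fop_D r) n \<noteq> (0 :: 'a)" if "r \<le> int n"
    using homogeneous_eig_mon(2)[where 'a = 'a, of "nat r" 0 n] int_power[of "nat (- r)"] that
    by (auto simp: fop_D_def binomial_eq_0_iff)
qed

section \<open>Uniqueness of the G-form\<close>

text \<open>Because \<open>D\<^sup>r\<close> maps \<open>x\<^bsup>m+r\<^esup>\<close> to a multiple of \<open>x\<^sup>m\<close>, the first factor of \<open>H\<close> is seen through its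
  action on \<open>x\<^sup>m\<close>. A common bound \<open>d\<close> for all \<open>i\<close> is more convenient than the individual bounds
  in the definition.\<close>

lemma gform_eig:
  assumes "gform k \<xi> r f g H"
  obtains d where "\<And>l i. f l i \<noteq> 0 \<Longrightarrow> i < k \<and> l \<le> d"
    and "\<And>m. int m + r \<ge> 0 \<Longrightarrow> eig r H (nat (int m + r))
      = ((\<Sum>i<k. \<Sum>l\<le>d. f l i * (of_nat m ^ l * \<xi> ^ (i * m))) + g (Suc m)) * eig r (fop_D r) (nat (int m + r))"
proof -
  from assms obtain d N where f: "\<And>l i. f l i \<noteq> 0 \<Longrightarrow> i < k \<and> l \<le> d i"
    and g: "\<And>j. g j \<noteq> 0 \<Longrightarrow> 0 < j \<and> j \<le> N"
    and H: "H = (\<lambda>s. (\<Sum>i<k. \<Sum>l\<le>d i. (f l i \<cdot>\<^sub>s (fop_Gamma l \<odot> fop_A \<xi> i)) s)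
              + (\<Sum>j=1..N. (g j \<cdot>\<^sub>s fop_B j) s)) \<odot> fop_D r"
    unfolding gform_def by blast
  define d' where "d' = (\<Sum>i<k. d i)"
  have d': "d i \<le> d'" if "i < k" for i
    unfolding d'_def using that by (intro member_le_sum) auto
  define HA where "HA i = (\<lambda>s. \<Sum>l\<le>d i. (f l i \<cdot>\<^sub>s (fop_Gamma l \<odot> fop_A \<xi> i)) s)" for i
  define HB where "HB = (\<lambda>s. \<Sum>j=1..N. (g j \<cdot>\<^sub>s fop_B j) s)"
  have HA: "homogeneous 0 (HA i)" "eig 0 (HA i) m = (\<Sum>l\<le>d i. f l i * (of_nat m ^ l * \<xi> ^ (i * m)))" for i m
    unfolding HA_def by (simp_all add: homogeneous_eig_sum homogeneous_eig_scale homogeneous_eig_Gamma_A)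
  have B: "homogeneous 0 (g j \<cdot>\<^sub>s fop_B j)" "eig 0 (g j \<cdot>\<^sub>s fop_B j) m = (if j = Suc m then g j else 0)"
    if "j \<in> {1..N}" for j m
    using that by (cases j; simp add: homogeneous_eig_scale homogeneous_eig_B)+
  have HB: "homogeneous 0 HB" "eig 0 HB m = g (Suc m)" for m
  proof -
    show "homogeneous 0 HB" unfolding HB_def by (intro homogeneous_eig_sum B) auto
    have "eig 0 HB m = (\<Sum>j=1..N. if j = Suc m then g j else 0)"
      unfolding HB_def by (subst homogeneous_eig_sum) (auto simp: B)
    then show "eig 0 HB m = g (Suc m)" using g[of "Suc m"] by auto
  qed
  have sumA: "homogeneous 0 (\<lambda>s. \<Sum>i<k. HA i s)"
    "eig 0 (\<lambda>s. \<Sum>i<k. HA i s) m = (\<Sum>i<k. \<Sum>l\<le>d i. f l i * (of_nat m ^ l * \<xi> ^ (i * m)))" for m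
    by (simp_all add: homogeneous_eig_sum HA)
  have sumAB: "homogeneous 0 (\<lambda>s. (\<Sum>i<k. HA i s) + HB s)"
    "eig 0 (\<lambda>s. (\<Sum>i<k. HA i s) + HB s) m
      = (\<Sum>i<k. \<Sum>l\<le>d i. f l i * (of_nat m ^ l * \<xi> ^ (i * m))) + g (Suc m)" for m
    using homogeneous_eig_add[OF sumA(1) HB(1)] by (simp_all add: sumA HB)
  have H': "H = (\<lambda>s. (\<Sum>i<k. HA i s) + HB s) \<odot> fop_D r"
    unfolding H HA_def HB_def ..
  show thesis
  proof (rule that)
    show "i < k \<and> l \<le> d'" if "f l i \<noteq> 0" for l i using f[OF that] d'[of i] by auto
    fix m assume m: "int m + r \<ge> 0"
    have "(\<Sum>i<k. \<Sum>l\<le>d i. f l i * (of_nat m ^ l * \<xi> ^ (i * m)))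
        = (\<Sum>i<k. \<Sum>l\<le>d'. f l i * (of_nat m ^ l * \<xi> ^ (i * m)))"
      using f d' by (intro sum.cong sum.mono_neutral_left) auto
    then show "eig r H (nat (int m + r))
      = ((\<Sum>i<k. \<Sum>l\<le>d'. f l i * (of_nat m ^ l * \<xi> ^ (i * m))) + g (Suc m)) * eig r (fop_D r) (nat (int m + r))"
      using eig_fop_mult[OF sumAB(1) homogeneous_eig_D(1), of r "nat (int m + r)"] m by (simp add: H' sumAB)
  qed
qed

text \<open>The difference of two G-forms acts by zero on all \<open>x\<^sup>m\<close> with \<open>m \<ge> 0\<close> and \<open>m + r \<ge> 0\<close>. For
  large \<open>m\<close> only the \<open>\<Gamma>\<^sub>l A\<^sub>i\<close> contribute, so that their coefficients agree by the independence
  of exponential polynomials; then \<open>m = j - 1\<close> yields the coefficients at \<open>B\<^sub>j\<close>. If \<open>r < 0\<close>, this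
  value of \<open>m\<close> is available only for \<open>j > - r\<close>, and the others vanish by the definition of a
  G-form: \<open>B\<^sub>j D\<^sup>r = 0\<close> for \<open>j \<le> - r\<close>.\<close>

lemma gform_unique:
  assumes k: "k > 0" and prim: "primitive_root_of_unity k \<xi>"
    and H: "gform k \<xi> r f g H" and H': "gform k \<xi> r f' g' H"
  shows "f = f'" "g = g'"
proof -
  from H H' obtain N N' where N: "\<And>j. g j \<noteq> 0 \<Longrightarrow> 0 < j \<and> j \<le> N" "\<And>j. g' j \<noteq> 0 \<Longrightarrow> 0 < j \<and> j \<le> N'"
    and neg: "\<And>j. r < 0 \<Longrightarrow> int j \<le> - r \<Longrightarrow> g j = 0 \<and> g' j = 0"
    unfolding gform_def by blast
  from gform_eig[OF H] obtain d where f: "\<And>l i. f l i \<noteq> 0 \<Longrightarrow> i < k \<and> l \<le> d"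
    and eig: "\<And>m. int m + r \<ge> 0 \<Longrightarrow> eig r H (nat (int m + r))
      = ((\<Sum>i<k. \<Sum>l\<le>d. f l i * (of_nat m ^ l * \<xi> ^ (i * m))) + g (Suc m)) * eig r (fop_D r) (nat (int m + r))"
    by blast
  from gform_eig[OF H'] obtain d' where f': "\<And>l i. f' l i \<noteq> 0 \<Longrightarrow> i < k \<and> l \<le> d'"
    and eig': "\<And>m. int m + r \<ge> 0 \<Longrightarrow> eig r H (nat (int m + r))
      = ((\<Sum>i<k. \<Sum>l\<le>d'. f' l i * (of_nat m ^ l * \<xi> ^ (i * m))) + g' (Suc m)) * eig r (fop_D r) (nat (int m + r))"
    by blast
  define F where "F i = (\<Sum>l\<le>d. monom (f l i) l) - (\<Sum>l\<le>d'. monom (f' l i) l)" for i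
  have coeff_F: "coeff (F i) l = f l i - f' l i" for i l
    using f[of l i] f'[of l i]
    by (cases "f l i = 0"; cases "f' l i = 0") (auto simp: F_def coeff_sum)
  have poly_F: "(\<Sum>i<k. \<xi> ^ (i * m) * poly (F i) (of_nat m)) + (g (Suc m) - g' (Suc m)) = 0"
    if "int m + r \<ge> 0" for m
  proof -
    have "eig r (fop_D r) (nat (int m + r)) \<noteq> (0::'a)" using that by (intro homogeneous_eig_D) auto
    then have "(\<Sum>i<k. \<Sum>l\<le>d. f l i * (of_nat m ^ l * \<xi> ^ (i * m))) + g (Suc m)
        = (\<Sum>i<k. \<Sum>l\<le>d'. f' l i * (of_nat m ^ l * \<xi> ^ (i * m))) + g' (Suc m)"
      using eig[OF that] eig'[OF that] by simp
    then show ?thesis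
      by (simp add: F_def poly_sum poly_monom right_diff_distrib sum_subtractf sum_distrib_left mult_ac)
        (simp add: algebra_simps)
  qed
  have F0: "F i = 0" if "i < k" for i
  proof (rule exponential_polynomial_eq_0[OF k prim _ that])
    fix m assume m: "m \<ge> N + N' + nat (- r)"
    then have "g (Suc m) = 0" "g' (Suc m) = 0" using N[of "Suc m"] by auto
    then show "(\<Sum>i<k. \<xi> ^ (i * m) * poly (F i) (of_nat m)) = 0" using poly_F[of m] m by simp
  qed
  show "f = f'"
  proof (intro ext)
    fix l i show "f l i = f' l i"
      using coeff_F[of i l] F0[of i] f[of l i] f'[of l i]
      by (cases "i < k"; cases "f l i = 0"; cases "f' l i = 0") auto
  qed
  show "g = g'"
  proof
    fix j show "g j = g' j"
    proof (cases "j = 0 \<or> int j \<le> - r")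
      case True
      then have "j = 0 \<or> r < 0 \<and> int j \<le> - r" by auto
      then show ?thesis
        using N[of j] neg[of j] by (cases "g j = 0"; cases "g' j = 0") auto
    next
      case False
      then obtain m where "j = Suc m" "int m + r \<ge> 0" by (cases j) auto
      then show ?thesis using poly_F[of m] F0 by simp
    qed
  qed
qed

section \<open>The shape of \<open>E(P)\<close>\<close>

lemma gform_zero: "gform k \<xi> r (\<lambda>_ _. 0) (\<lambda>_. 0) (\<lambda>_. 0)"
  by (auto simp: gform_def fop_mult_def fop_scale_def fun_eq_iff fps_eq_iff intro!: exI[of _ "\<lambda>_. 0"])

text \<open>The coefficients are defined by a definite description, so this depends on the uniqueness of
  the G-form.\<close>

lemma coeffA_zero:
  assumes "k > 0" "primitive_root_of_unity k \<xi>"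
  shows "coeffA k \<xi> r (\<lambda>_. 0) = (\<lambda>_ _. 0)"
proof -
  have "gcoeffs k \<xi> r (\<lambda>_. 0) = (\<lambda>_ _. 0, \<lambda>_. 0)"
    unfolding gcoeffs_def
    by (rule the_equality) (use gform_zero gform_unique[OF assms _ gform_zero] in \<open>auto simp: prod_eq_iff\<close>)
  then show ?thesis by (simp add: coeffA_def)
qed

lemma hcomp_above_ord:
  assumes "fop_ord P = ereal (of_int p)" "r > p"
  shows "hcomp P r = (\<lambda>_. 0)"
proof -
  have "fps_nth (P s) i = 0" if "int s - int i = r" for s i
  proof (rule ccontr)
    assume nz: "fps_nth (P s) i \<noteq> 0"
    then have "ereal (real s - real (subdegree (P s))) \<le> fop_ord P"
      unfolding fop_ord_def by (intro SUP_upper) auto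
    then have "int s - int (subdegree (P s)) \<le> p" using assms(1) by simp
    moreover have "subdegree (P s) \<le> i" using nz by (rule subdegree_leI)
    ultimately show False using that assms(2) by linarith
  qed
  then show ?thesis by (auto simp: hcomp_def fun_eq_iff fps_eq_iff)
qed

lemma E_op_iff: "(l, r) \<in> E_op k \<xi> P \<longleftrightarrow> (\<exists>i. coeffA k \<xi> r (hcomp P r) l i \<noteq> 0)"
  by (auto simp: E_op_def E_HCP_def)

lemma SdegA_op_eq: "SdegA_op k \<xi> P = (SUP (l, r) \<in> E_op k \<xi> P. ereal (real l))"
proof (rule antisym)
  show "SdegA_op k \<xi> P \<le> (SUP (l, r) \<in> E_op k \<xi> P. ereal (real l))"
    unfolding SdegA_op_def SdegA_def
  proof (intro SUP_least)
    fix r l assume "l \<in> {l. \<exists>i. coeffA k \<xi> r (hcomp P r) l i \<noteq> 0}"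
    then have "(l, r) \<in> E_op k \<xi> P" by (simp add: E_op_iff)
    then show "ereal (real l) \<le> (SUP (l, r) \<in> E_op k \<xi> P. ereal (real l))"
      by (rule SUP_upper2) simp
  qed
  show "(SUP (l, r) \<in> E_op k \<xi> P. ereal (real l)) \<le> SdegA_op k \<xi> P"
  proof (rule SUP_least, clarify)
    fix l r assume "(l, r) \<in> E_op k \<xi> P"
    then have "ereal (real l) \<le> SdegA k \<xi> r (hcomp P r)"
      unfolding SdegA_def by (intro SUP_upper) (auto simp: E_op_iff)
    also have "\<dots> \<le> SdegA_op k \<xi> P"
      unfolding SdegA_op_def by (rule SUP_upper) simp
    finally show "ereal (real l) \<le> SdegA_op k \<xi> P" .
  qed
qed

text \<open>The bound for \<open>r < p\<close> is the condition on \<open>Sdeg\<^sub>A\<close> of the lower components, and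
  \<open>Sdeg\<^sub>A(\<sigma>(P)) = 0\<close> leaves only \<open>(0, p)\<close> in order \<open>p\<close>. There are no points of order \<open>r > p\<close>, as the components vanish there.\<close>

lemma cond_A0_E_op:
  assumes "k > 0" "primitive_root_of_unity k \<xi>" "cond_A0 k \<xi> P" "fop_ord P = ereal (of_int p)"
  shows "(0, p) \<in> E_op k \<xi> P"
    and "(l, r) \<in> E_op k \<xi> P \<Longrightarrow> (l, r) = (0, p) \<or> int l < p - r"
proof -
  from assms(3,4) have low: "\<And>i::int. i > 0 \<Longrightarrow> SdegA k \<xi> (p - i) (hcomp P (p - i)) < ereal (of_int i)"
    and top: "SdegA k \<xi> p (hcomp P p) = 0"
    by (auto simp: cond_A0_def)
  have SdegA: "ereal (real l) \<le> SdegA k \<xi> r (hcomp P r)" if "(l, r) \<in> E_op k \<xi> P" for l r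
    using that unfolding SdegA_def by (intro SUP_upper) (auto simp: E_op_iff)
  show "(l, r) = (0, p) \<or> int l < p - r" if lr: "(l, r) \<in> E_op k \<xi> P"
  proof (cases r p rule: linorder_cases)
    case less
    then have "ereal (real l) < ereal (of_int (p - r))"
      by (intro order.strict_trans1[OF SdegA[OF lr]]) (use low[of "p - r"] in simp)
    then have "real_of_int (int l) < real_of_int (p - r)" by simp
    then have "int l < p - r" by (simp only: of_int_less_iff)
    then show ?thesis by simp
  next
    case equal
    then show ?thesis using SdegA[OF lr] top by (simp add: zero_ereal_def)
  next
    case greater
    then show ?thesis using lr hcomp_above_ord[OF assms(4)] coeffA_zero[OF assms(1,2)] by (simp add: E_op_iff)
  qed
  have "\<exists>l. (l, p) \<in> E_op k \<xi> P"
  proof (rule ccontr)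
    assume "\<not> ?thesis"
    then have "{l. \<exists>i. coeffA k \<xi> p (hcomp P p) l i \<noteq> 0} = {}" by (auto simp: E_op_iff)
    then show False using top by (simp add: SdegA_def bot_ereal_def)
  qed
  then show "(0, p) \<in> E_op k \<xi> P"
    using SdegA top by (force simp: zero_ereal_def)
qed

section \<open>Top lines through the vertex\<close>

lemma is_top_line_through_vertex:
  assumes p: "(0, p) \<in> E_op k \<xi> P"
  shows "is_top_line k \<xi> P \<sigma> 1 (plane_line \<sigma> 1 (of_int p)) \<longleftrightarrow>
    \<sigma> \<ge> 0 \<and> (\<forall>(l, j) \<in> E_op k \<xi> P. \<sigma> * real l + of_int j \<le> of_int p)" (is "?lhs \<longleftrightarrow> ?rhs")
proof
  assume lhs: ?lhs
  then obtain l j where lj: "ereal (\<sigma> * real l + of_int j) = v_op k \<xi> \<sigma> 1 P"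
    by (auto simp: is_top_line_def)
  have "plane_line \<sigma> 1 (of_int p) = plane_line \<sigma> 1 (real_of_ereal (v_op k \<xi> \<sigma> 1 P))"
    using lhs by (simp add: is_top_line_def)
  moreover have "(0, real_of_int p) \<in> plane_line \<sigma> 1 (of_int p)"
    by (simp add: plane_line_def)
  ultimately have "(0, real_of_int p) \<in> plane_line \<sigma> 1 (real_of_ereal (v_op k \<xi> \<sigma> 1 P))"
    by simp
  then have "real_of_int p = real_of_ereal (v_op k \<xi> \<sigma> 1 P)"
    by (simp add: plane_line_def)
  then have v: "v_op k \<xi> \<sigma> 1 P = ereal (of_int p)"
    using lj by (metis real_of_ereal.simps(1))
  have "ereal (\<sigma> * real l + of_int j) \<le> v_op k \<xi> \<sigma> 1 P" if "(l, j) \<in> E_op k \<xi> P" for l j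
    unfolding v_op_def using that by (rule SUP_upper2) simp
  then show ?rhs using lhs by (auto simp: is_top_line_def v)
next
  assume rhs: ?rhs
  have "v_op k \<xi> \<sigma> 1 P = ereal (of_int p)"
    unfolding v_op_def
    by (intro antisym SUP_least SUP_upper2[OF p]) (use rhs in auto)
  then show ?lhs using rhs p by (force simp: is_top_line_def)
qed

text \<open>The values of \<open>\<sigma>\<close> for which the line \<open>\<sigma> X + Y = p\<close> meets a point of \<open>E\<close> off the axis
  \<open>X = 0\<close>: the negatives of the slopes, in the usual sense, of the lines that join the vertex
  \<open>(0, p)\<close> with such points.\<close>

definition slopes :: "int \<Rightarrow> (nat \<times> int) set \<Rightarrow> real set" where
  "slopes p E = (\<lambda>(l, j). real_of_int (p - j) / real l) ` {(l, j) \<in> E. l > 0}"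

lemma slopes_gt_1:
  assumes below: "\<And>l j. (l, j) \<in> E \<Longrightarrow> (l, j) = (0, p) \<or> int l < p - j"
    and "s \<in> slopes p E"
  shows "s > 1"
proof -
  obtain l j where lj: "(l, j) \<in> E" "l > 0" and s: "s = real_of_int (p - j) / real l"
    using assms(2) by (auto simp: slopes_def)
  have "int l < p - j" using below[OF lj(1)] lj(2) by auto
  then have "real l < real_of_int (p - j)" by linarith
  then show ?thesis using lj(2) s by simp
qed

lemma below_line_iff_le_slopes:
  assumes below: "\<And>l j. (l, j) \<in> E \<Longrightarrow> (l, j) = (0, p) \<or> int l < p - j"
  shows "(\<forall>(l, j) \<in> E. \<sigma> * real l + of_int j \<le> of_int p) \<longleftrightarrow> (\<forall>s \<in> slopes p E. \<sigma> \<le> s)"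
proof -
  have "\<sigma> * real l + of_int j \<le> of_int p \<longleftrightarrow> (l > 0 \<longrightarrow> \<sigma> \<le> real_of_int (p - j) / real l)"
    if "(l, j) \<in> E" for l j
    using below[OF that] by (cases "l = 0") (auto simp: field_simps)
  then show ?thesis by (force simp: slopes_def)
qed

lemma is_top_line_iff_le_slopes:
  assumes p: "(0, p) \<in> E_op k \<xi> P"
    and below: "\<And>l j. (l, j) \<in> E_op k \<xi> P \<Longrightarrow> (l, j) = (0, p) \<or> int l < p - j"
  shows "is_top_line k \<xi> P \<sigma> 1 (plane_line \<sigma> 1 (of_int p))
    \<longleftrightarrow> \<sigma> \<ge> 0 \<and> (\<forall>s \<in> slopes p (E_op k \<xi> P). \<sigma> \<le> s)"
  by (simp only: is_top_line_through_vertex[OF p] below_line_iff_le_slopes[OF below])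

text \<open>The positive \<open>\<sigma>\<close> that belong to top lines through the vertex form the interval
  from 0 to the infimum of the slopes, including this infimum, which is at least 1. So the
  infimum is the only possible \<open>\<sigma>\<^sub>0\<close>. If there are no slopes then all positive \<open>\<sigma>\<close> occur and there
  is no \<open>\<sigma>\<^sub>0\<close>.\<close>

lemma asymptotic_top_line_iff_slopes:
  assumes p: "(0, p) \<in> E_op k \<xi> P"
    and below: "\<And>l j. (l, j) \<in> E_op k \<xi> P \<Longrightarrow> (l, j) = (0, p) \<or> int l < p - j"
  shows "is_asymptotic_top_line k \<xi> P p L \<longleftrightarrow>
    \<not> (\<exists>L'. is_restriction_top_line k \<xi> P p L') \<and> slopes p (E_op k \<xi> P) \<noteq> {}
      \<and> L = plane_line (Inf (slopes p (E_op k \<xi> P))) 1 (of_int p)"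
proof -
  let ?S = "slopes p (E_op k \<xi> P)"
  have gt1: "s > 1" if "s \<in> ?S" for s by (rule slopes_gt_1[OF below that])
  have bdd: "bdd_below ?S" using gt1 by (meson bdd_below.I less_imp_le)
  have top_iff: "is_top_line k \<xi> P \<sigma> 1 (plane_line \<sigma> 1 (of_int p)) \<longleftrightarrow> (?S \<noteq> {} \<longrightarrow> \<sigma> \<le> Inf ?S)"
    if "\<sigma> > 0" for \<sigma>
    using that bdd by (auto simp: is_top_line_iff_le_slopes[OF p below] le_cInf_iff)
  have "(\<exists>\<sigma>\<^sub>0>0. L = plane_line \<sigma>\<^sub>0 1 (of_int p) \<and> is_top_line k \<xi> P \<sigma>\<^sub>0 1 L \<and>
        (\<forall>\<sigma>>\<sigma>\<^sub>0. \<not> is_top_line k \<xi> P \<sigma> 1 (plane_line \<sigma> 1 (of_int p))))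
    \<longleftrightarrow> ?S \<noteq> {} \<and> L = plane_line (Inf ?S) 1 (of_int p)" (is "?lhs \<longleftrightarrow> ?rhs")
  proof
    assume ?lhs
    then obtain \<sigma>\<^sub>0 where \<sigma>0: "\<sigma>\<^sub>0 > 0" "L = plane_line \<sigma>\<^sub>0 1 (of_int p)"
      and top: "is_top_line k \<xi> P \<sigma>\<^sub>0 1 L"
      and not_top: "\<And>\<sigma>. \<sigma> > \<sigma>\<^sub>0 \<Longrightarrow> \<not> is_top_line k \<xi> P \<sigma> 1 (plane_line \<sigma> 1 (of_int p))"
      by blast
    have le: "?S \<noteq> {} \<longrightarrow> \<sigma>\<^sub>0 \<le> Inf ?S"
      using top \<sigma>0 by (simp add: top_iff)
    have max: "?S \<noteq> {} \<and> Inf ?S < \<sigma>" if "\<sigma> > \<sigma>\<^sub>0" for \<sigma>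
      using not_top[OF that] that \<sigma>0(1) by (auto simp: top_iff)
    have S: "?S \<noteq> {}" using max[of "\<sigma>\<^sub>0 + 1"] by simp
    moreover have "\<sigma>\<^sub>0 = Inf ?S" using S le max[of "Inf ?S"] by force
    ultimately show ?rhs using \<sigma>0(2) by simp
  next
    assume rhs: ?rhs
    have "Inf ?S \<ge> 1" using rhs gt1 by (intro cInf_greatest) (auto simp: less_imp_le)
    then show ?lhs using rhs by (intro exI[of _ "Inf ?S"]) (auto simp: top_iff)
  qed
  then show ?thesis by (simp add: is_asymptotic_top_line_def)
qed

lemma SdegA_op_slopes:
  assumes p: "(0, p) \<in> E_op k \<xi> P"
  shows "SdegA_op k \<xi> P = 0 \<longleftrightarrow> slopes p (E_op k \<xi> P) = {}"
    and "SdegA_op k \<xi> P > 0 \<longleftrightarrow> slopes p (E_op k \<xi> P) \<noteq> {}"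
proof -
  have "SdegA_op k \<xi> P \<ge> 0"
    unfolding SdegA_op_eq by (rule SUP_upper2[OF p]) simp
  moreover have pos: "SdegA_op k \<xi> P > 0 \<longleftrightarrow> slopes p (E_op k \<xi> P) \<noteq> {}"
    by (force simp: SdegA_op_eq less_SUP_iff slopes_def)
  ultimately show "SdegA_op k \<xi> P = 0 \<longleftrightarrow> slopes p (E_op k \<xi> P) = {}"
    by (metis less_irrefl order_le_less)
  show "SdegA_op k \<xi> P > 0 \<longleftrightarrow> slopes p (E_op k \<xi> P) \<noteq> {}" by (rule pos)
qed

theorem lemma2p1:
  fixes K :: "'a::field_char_0 set" and \<xi> :: 'a and k :: nat
    and P :: "'a fop" and p :: int
  assumes "is_subfield K" and "k > 1" and "primitive_root_of_unity k \<xi>"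
    and "adjoin K \<xi> = UNIV"
    and "P \<in> Dsym" and "cond_A0 k \<xi> P" and "fop_ord P = ereal (of_int p)"
  shows "(let C1 = (SdegA_op k \<xi> P = 0);
              C2 = (SdegA_op k \<xi> P > 0 \<and> (\<exists>L. is_restriction_top_line k \<xi> P p L));
              C3 = (SdegA_op k \<xi> P > 0 \<and> (\<exists>L. is_asymptotic_top_line k \<xi> P p L))
          in (C1 \<and> \<not> C2 \<and> \<not> C3) \<or> (\<not> C1 \<and> C2 \<and> \<not> C3) \<or> (\<not> C1 \<and> \<not> C2 \<and> C3))
       \<and> (\<forall>L L'. is_asymptotic_top_line k \<xi> P p L \<and> is_asymptotic_top_line k \<xi> P p L'
             \<longrightarrow> L = L')"
proof -
  have k: "k > 0" using assms(2) by simp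
  note p = cond_A0_E_op(1)[OF k assms(3) assms(6,7)]
    and below = cond_A0_E_op(2)[OF k assms(3) assms(6,7)]
  show ?thesis
    unfolding Let_def SdegA_op_slopes[OF p] using asymptotic_top_line_iff_slopes[OF p below]
    by blast
qed

end
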